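(* For any complete graph $K_n$ of order $n\ge 4$, $\gamma_{tc}(M(K_n))=\lceil 2n/3\rceil$.
   Context: All graphs are finite, simple and undirected. For a graph $H$, a set $D\subseteq V(H)$ is a total dominating set if every vertex of $H$ has a neighbor in $D$. A set $D\subseteq V(H)$ is a total outer-connected dominating set of $H$ if $D$ is a total dominating set and the induced subgraph $H[V(H)\setminus D]$ is connected; $\gamma_{tc}(H)$ denotes the minimum cardinality of a total outer-connected dominating set of $H$. The middle graph $M(G)$ of a graph $G$ has vertex set $V(G)\cup E(G)$, where two elements $x,y$ are adjacent iff either $x,y\in E(G)$ are edges of $G$ sharing an endpoint, or one of them is a vertex of $G$ and the other is an edge of $G$ incident to it. *)

theory Defs
  imports Complex_Main "Graph_Theory.Graph_Theory"
begin

text \<open>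
  As in the imported library, a finite simple undirected graph is a symmetric digraph
  satisfying the locale \<^locale>\<open>graph\<close>; the undirected edge joining \<open>u\<close> and \<open>v\<close> is the
  two-element set \<open>{u, v}\<close>, represented by the two arcs \<open>(u, v)\<close> and \<open>(v, u)\<close>.
\<close>

definition edge_set :: "('a, 'b) pre_digraph \<Rightarrow> 'a set set" where
  "edge_set G = {{u, v} | u v. u \<rightarrow>\<^bsub>G\<^esub> v}"

definition middle_graph :: "('a, 'b) pre_digraph \<Rightarrow> ('a + 'a set) pair_pre_digraph" where
  "middle_graph G =
    \<lparr> pverts = Inl ` verts G \<union> Inr ` edge_set G,
      parcs =
        {(Inr e, Inr f) | e f. e \<in> edge_set G \<and> f \<in> edge_set G \<and> e \<noteq> f \<and> e \<inter> f \<noteq> {}}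
        \<union> {(Inl v, Inr e) | v e. v \<in> verts G \<and> e \<in> edge_set G \<and> v \<in> e}
        \<union> {(Inr e, Inl v) | v e. v \<in> verts G \<and> e \<in> edge_set G \<and> v \<in> e} \<rparr>"

definition total_dominating_set :: "('a, 'b) pre_digraph \<Rightarrow> 'a set \<Rightarrow> bool" where
  "total_dominating_set H D \<longleftrightarrow> D \<subseteq> verts H \<and> (\<forall>v \<in> verts H. \<exists>u \<in> D. v \<rightarrow>\<^bsub>H\<^esub> u)"

text \<open>The qualifier in the next definition avoids the topological predicate of the same name.
  The library's graph connectedness excludes the graph without vertices.\<close>

definition total_outer_connected_dominating_set :: "('a, 'b) pre_digraph \<Rightarrow> 'a set \<Rightarrow> bool" where
  "total_outer_connected_dominating_set H D \<longleftrightarrow>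
    total_dominating_set H D \<and> Digraph_Component.connected (H \<restriction> (verts H - D))"

definition total_outer_connected_domination_number :: "('a, 'b) pre_digraph \<Rightarrow> nat" (\<open>\<gamma>\<^sub>t\<^sub>c\<close>) where
  "\<gamma>\<^sub>t\<^sub>c H = Min (card ` {D. total_outer_connected_dominating_set H D})"

lemma graph_middle_graph:
  assumes "graph G"
  shows "graph (with_proj (middle_graph G))"
proof -
  interpret graph G by fact
  have "edge_set G \<subseteq> Pow (verts G)"
    by (auto simp: edge_set_def dest: adj_in_verts)
  then have fin: "finite (edge_set G)"
    using finite_verts by (meson finite_Pow_iff finite_subset)
  have sub: "parcs (middle_graph G) \<subseteq> pverts (middle_graph G) \<times> pverts (middle_graph G)"
    by (auto simp: middle_graph_def)
  have finv: "finite (pverts (middle_graph G))"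
    using fin by (simp add: middle_graph_def)
  then have fina: "finite (parcs (middle_graph G))"
    using sub by (meson finite_SigmaI finite_subset)
  have "pair_graph (middle_graph G)"
  proof
    show "symmetric (with_proj (middle_graph G))"
      by (auto simp: symmetric_def middle_graph_def intro!: symI)
    show "fst e \<noteq> snd e" if "e \<in> parcs (middle_graph G)" for e
      using that by (auto simp: middle_graph_def)
  qed (use sub finv fina in auto)
  then interpret M: pair_graph "middle_graph G" .
  show ?thesis by unfold_locales
qed

end

theory Submission
  imports Defs
begin

text \<open>
  Lower bound, for every graph: let every element of a total dominating set of the middle graph
  hold three units of charge.
  A vertex in the set keeps its charge.  Call a vertex saturated if it lies in the set or
  on at least two edges of the set; an edge in the set gives one unit to each saturated
  endpoint and two units to each other endpoint.  Domination of the edge inside the set forces one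
  endpoint to be saturated, so no edge overspends, and every vertex receives at least two units.

  Upper bound: order the vertices of the complete graph along a Hamiltonian path and omit every third
  edge of it, except near the end, so that the remaining edges form paths with 3, 4 or 5 vertices.
  The complement of a path on at least four vertices is connected, and so is its middle graph.
\<close>

section \<open>Middle graphs\<close>

lemma pverts_middle_graph:
  "pverts (middle_graph G) = Inl ` verts G \<union> Inr ` edge_set G"
  by (simp add: middle_graph_def)

lemma parcs_middle_graph_iff:
  "(Inl v, Inl w) \<in> parcs (middle_graph G) \<longleftrightarrow> False"
  "(Inl v, Inr e) \<in> parcs (middle_graph G) \<longleftrightarrow> v \<in> verts G \<and> e \<in> edge_set G \<and> v \<in> e"
  "(Inr e, Inl v) \<in> parcs (middle_graph G) \<longleftrightarrow> v \<in> verts G \<and> e \<in> edge_set G \<and> v \<in> e"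
  "(Inr e, Inr f) \<in> parcs (middle_graph G) \<longleftrightarrow>
     e \<in> edge_set G \<and> f \<in> edge_set G \<and> e \<noteq> f \<and> e \<inter> f \<noteq> {}"
  by (auto simp: middle_graph_def)

lemma (in graph) edge_setE:
  assumes "e \<in> edge_set G"
  obtains u v where "e = {u, v}" "u \<noteq> v" "u \<in> verts G" "v \<in> verts G"
  using assms by (auto simp: edge_set_def dest: adj_not_same adj_in_verts)

lemma (in graph) finite_edge_set: "finite (edge_set G)"
proof -
  have "edge_set G \<subseteq> Pow (verts G)"
    by (auto elim: edge_setE)
  then show ?thesis
    by (rule finite_subset) simp
qed

section \<open>The lower bound\<close>

lemma (in graph) total_dominating_set_middle_graph_card:
  assumes D: "total_dominating_set (with_proj (middle_graph G)) D"
  shows "2 * card (verts G) \<le> 3 * card D"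
proof -
  let ?M = "with_proj (middle_graph G)"
  let ?V = "verts G"
  define F where "F = {e. Inr e \<in> D}"
  define U where "U = {v. Inl v \<in> D}"
  define inc where "inc v = {e \<in> F. v \<in> e}" for v
  define S where "S = {v. v \<in> U \<or> 2 \<le> card (inc v)}"
  \<comment> \<open>\<open>w v\<close> is the charge that an edge of \<open>F\<close> passes to an
    endpoint \<open>v\<close>: one unit if \<open>v\<close> is saturated (\<open>v \<in> S\<close>),
    two otherwise.\<close>
  define w where "w v = (if v \<in> S then 1 else 2 :: nat)" for v
  have DV: "D \<subseteq> Inl ` ?V \<union> Inr ` edge_set G"
    using D by (simp add: total_dominating_set_def pverts_middle_graph)
  have F: "F \<subseteq> edge_set G" and U: "U \<subseteq> ?V"
    using DV by (auto simp: F_def U_def)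
  have finF: "finite F" and finU: "finite U"
    using F U finite_edge_set finite_verts by (auto intro: finite_subset)
  have fininc: "finite (inc v)" for v
    using finF by (simp add: inc_def)
  have "D = U <+> F"
  proof (rule set_eqI)
    show "x \<in> D \<longleftrightarrow> x \<in> U <+> F" for x
      by (cases x) (auto simp: U_def F_def)
  qed
  then have cardD: "card D = card U + card F"
    using finU finF by (simp add: card_Plus)
  have dom: "\<exists>u\<in>D. x \<rightarrow>\<^bsub>?M\<^esub> u" if "x \<in> verts ?M" for x
    using D that by (simp add: total_dominating_set_def)

  \<comment> \<open>Vertices of \<open>G\<close> are adjacent only to edges in the middle graph, so
    the dominator of \<open>v\<close> is an edge and \<open>inc v\<close> is nonempty. A member of
    \<open>U\<close> already holds 3; any other saturated vertex gets 1 + 1 from two edges; an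
    unsaturated one gets 2 from its single edge.\<close>
  have received: "2 \<le> (if v \<in> U then 3 else 0) + (\<Sum>e\<in>inc v. w v)" if v: "v \<in> ?V" for v
  proof -
    obtain u where u: "u \<in> D" "Inl v \<rightarrow>\<^bsub>?M\<^esub> u"
      using dom[of "Inl v"] v by (auto simp: pverts_middle_graph)
    then obtain e where "u = Inr e"
      by (cases u) (simp_all add: parcs_middle_graph_iff)
    then have "e \<in> inc v"
      using u by (simp add: parcs_middle_graph_iff inc_def F_def)
    then have "1 \<le> card (inc v)"
      using fininc by (metis One_nat_def Suc_leI card_gt_0_iff empty_iff)
    then show ?thesis
      by (auto simp: w_def S_def)
  qed

  have spent: "(\<Sum>v\<in>e. w v) \<le> 3" if e: "e \<in> F" for e
  proof -
    have eE: "e \<in> edge_set G"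
      using e F by blast
    then obtain a b where ab: "e = {a, b}" "a \<noteq> b"
      by (rule edge_setE)
    obtain u where u: "u \<in> D" "Inr e \<rightarrow>\<^bsub>?M\<^esub> u"
      using dom[of "Inr e"] eE by (auto simp: pverts_middle_graph)
    \<comment> \<open>The dominator of \<open>e\<close> is either an endpoint, which lies in
      \<open>U\<close>, or another edge \<open>f\<close> of \<open>F\<close> meeting
      \<open>e\<close> in some \<open>x\<close>, and then \<open>inc x\<close> contains both
      \<open>e\<close> and \<open>f\<close>.\<close>
    have "\<exists>x\<in>e. x \<in> S"
    proof (cases u)
      case (Inl x)
      then have "x \<in> e" "x \<in> U"
        using u by (simp_all add: parcs_middle_graph_iff U_def)
      then show ?thesis
        by (auto simp: S_def)
    next
      case (Inr f)
      then have "f \<noteq> e" "e \<inter> f \<noteq> {}" "f \<in> F"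
        using u by (auto simp: parcs_middle_graph_iff F_def)
      then obtain x where x: "x \<in> e" "{e, f} \<subseteq> inc x"
        using e by (auto simp: inc_def)
      then have "card {e, f} \<le> card (inc x)"
        using fininc by (intro card_mono)
      then have "x \<in> S"
        using \<open>f \<noteq> e\<close> by (simp add: S_def)
      then show ?thesis
        using x by blast
    qed
    then show ?thesis
      using ab by (auto simp: w_def)
  qed

  have "2 * card ?V = (\<Sum>v\<in>?V. 2)"
    by simp
  also have "\<dots> \<le> (\<Sum>v\<in>?V. (if v \<in> U then 3 else 0) + (\<Sum>e\<in>inc v. w v))"
    using received by (intro sum_mono) auto
  also have "\<dots> = 3 * card U + (\<Sum>v\<in>?V. \<Sum>e\<in>inc v. w v)"
    using U by (simp add: sum.distrib sum.If_cases Int_absorb1)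
  \<comment> \<open>Double counting of incident pairs: the charge is now summed over the giving
    edges, where \<open>spent\<close> bounds it.\<close>
  also have "(\<Sum>v\<in>?V. \<Sum>e\<in>inc v. w v) = (\<Sum>e\<in>F. \<Sum>v | v \<in> ?V \<and> v \<in> e. w v)"
    unfolding inc_def using finF by (intro sum.swap_restrict) auto
  also have "\<dots> = (\<Sum>e\<in>F. \<Sum>v\<in>e. w v)"
  proof (intro sum.cong refl)
    fix e assume "e \<in> F"
    then show "{v. v \<in> ?V \<and> v \<in> e} = e"
      using F by (auto elim: edge_setE)
  qed
  also have "\<dots> \<le> (\<Sum>e\<in>F. 3)"
    by (intro sum_mono spent)
  finally show ?thesis
    by (simp add: cardD)
qed

section \<open>The upper bound\<close>

text \<open>Connectedness is strong connectivity of the symmetric closure. There, routes into the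
  root can be reversed, so any two vertices are linked through \<open>r\<close>.\<close>

lemma (in wf_digraph) connected_if_all_reach:
  assumes r: "r \<in> verts G" and reach: "\<And>v. v \<in> verts G \<Longrightarrow> v \<rightarrow>\<^sup>*\<^bsub>G\<^esub> r"
  shows "Digraph_Component.connected G"
proof -
  interpret S: pair_wf_digraph "mk_symmetric G" ..
  have to: "v \<rightarrow>\<^sup>*\<^bsub>mk_symmetric G\<^esub> r" if "v \<in> verts G" for v
    using reach[OF that] by (rule reachable_mk_symmetricI)
  have from_r: "r \<rightarrow>\<^sup>*\<^bsub>mk_symmetric G\<^esub> v" if "v \<in> verts G" for v
    using to[OF that] by (rule symmetric_reachable[OF symmetric_mk_symmetric])
  have V: "verts (mk_symmetric G) = verts G"
    by (simp add: mk_symmetric_def)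
  show ?thesis
    unfolding connected_def
  proof (rule strongly_connectedI)
    show "verts (mk_symmetric G) \<noteq> {}"
      using r V by auto
    show "u \<rightarrow>\<^sup>*\<^bsub>mk_symmetric G\<^esub> v"
      if "u \<in> verts (mk_symmetric G)" "v \<in> verts (mk_symmetric G)" for u v
      using to[of u] from_r[of v] that unfolding V by (blast intro: S.reachable_trans)
  qed
qed

text \<open>Index \<open>i\<close> stands for the path edge between positions \<open>i\<close> and
  \<open>i + 1\<close>. The disjunct \<open>n \<le> i + 3\<close> always keeps the last two edges,
  so the final piece has 3, 4 or 5 vertices and no leftover of one or two vertices arises.\<close>

definition path_cover_indices :: "nat \<Rightarrow> nat set" where
  "path_cover_indices n = {i. i + 1 < n \<and> (i mod 3 \<noteq> 2 \<or> n \<le> i + 3)}"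

lemma finite_path_cover_indices: "finite (path_cover_indices n)"
  by (rule finite_subset[of _ "{..<n}"]) (auto simp: path_cover_indices_def)

text \<open>Of the \<open>n - 1\<close> path edges, those with index
  \<open>3 * j + 2 \<le> n - 4\<close> are omitted; there are \<open>(n - 3) div 3\<close> of them.
  The bound is sharp enough because the ceiling of 2n/3 is the floor of (2n+2)/3.\<close>

lemma card_path_cover_indices:
  assumes "3 \<le> n"
  shows "3 * card (path_cover_indices n) \<le> 2 * n + 2"
proof -
  let ?X = "(\<lambda>j. 3 * j + 2) ` {..<(n - 3) div 3}"
  have X: "?X \<subseteq> {..<n - 1}"
    by auto
  have "path_cover_indices n \<subseteq> {..<n - 1} - ?X"
    by (auto simp: path_cover_indices_def mod_Suc)
  then have "card (path_cover_indices n) \<le> card ({..<n - 1} - ?X)"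
    by (intro card_mono) auto
  also have "\<dots> = (n - 1) - card ?X"
    using X by (subst card_Diff_subset) (auto intro: finite_subset)
  also have "card ?X = (n - 3) div 3"
    by (subst card_image) (auto intro: inj_onI)
  finally show ?thesis
    using assms by linarith
qed

text \<open>If \<open>i\<close> is not kept, it is either the last position or congruent to 2 modulo
  3; in both cases the path edge just before it is kept.\<close>

lemma path_cover_indices_cover:
  assumes "3 \<le> n" "i < n"
  obtains j where "j \<in> path_cover_indices n" "i \<in> {j, j + 1}"
proof (cases "i \<in> path_cover_indices n")
  case False
  then obtain k where "i = Suc k" "k \<in> path_cover_indices n"
    using assms by (cases i) (auto simp: path_cover_indices_def mod_Suc split: if_splits)
  then show ?thesis
    using that by auto
qed (use that in auto)

text \<open>Every piece has at least two edges, so each chosen edge meets another chosen one. If the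
  next edge is missing, \<open>i\<close> is \<open>n - 2\<close> or congruent to 1 modulo 3, and the
  previous edge is kept.\<close>

lemma path_cover_indices_neighbour:
  assumes "3 \<le> n" "i \<in> path_cover_indices n"
  obtains j where "j \<in> path_cover_indices n" "j = i + 1 \<or> i = j + 1"
proof (cases "i + 1 \<in> path_cover_indices n")
  case False
  then obtain k where "i = Suc k" "k \<in> path_cover_indices n"
    using assms by (cases i) (auto simp: path_cover_indices_def mod_Suc split: if_splits)
  then show ?thesis
    using that by auto
qed (use that in auto)

lemma complete_digraph_edge_set:
  assumes "complete_digraph n G"
  shows "edge_set G = {{u, v} | u v. u \<in> verts G \<and> v \<in> verts G \<and> u \<noteq> v}"
  using assms by (auto simp: edge_set_def complete_digraph_def)

lemma complete_digraph_middle_graph_witness: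
  assumes n: "4 \<le> n" and K: "complete_digraph n G"
  obtains D where "total_outer_connected_dominating_set (with_proj (middle_graph G)) D"
    "3 * card D \<le> 2 * n + 2"
proof -
  interpret graph G
    using K by (simp add: complete_digraph_def)
  let ?M = "with_proj (middle_graph G)"
  interpret M: graph ?M
    by (rule graph_middle_graph) unfold_locales
  have "card (verts G) = n"
    using K by (simp add: complete_digraph_def)
  then obtain h where h: "bij_betw h {..<n} (verts G)"
    using ex_bij_betw_nat_finite[OF finite_verts] by (auto simp: atLeast0LessThan)
  have h_in: "h i \<in> verts G" if "i < n" for i
    using h that by (auto simp: bij_betw_def)
  have h_eq: "h i = h j \<longleftrightarrow> i = j" if "i < n" "j < n" for i j
    using h that by (auto simp: bij_betw_def inj_on_def)
  have vertE: "\<exists>i<n. v = h i" if "v \<in> verts G" for v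
    using h that by (auto simp: bij_betw_def)
  have edgeI: "{h i, h j} \<in> edge_set G" if "i < n" "j < n" "i \<noteq> j" for i j
    unfolding complete_digraph_edge_set[OF K] using that h_in h_eq by blast

  let ?I = "path_cover_indices n"
  define p where "p i = {h i, h (i + 1)}" for i
  \<comment> \<open>\<open>D\<close> consists of edges only, so all vertices of \<open>G\<close>
    remain in the complement.\<close>
  define D where "D = (Inr ` p ` ?I :: ('a + 'a set) set)"
  have I_less: "i + 1 < n" if "i \<in> ?I" for i
    using that by (simp add: path_cover_indices_def)
  have p_edge: "p i \<in> edge_set G" if "i \<in> ?I" for i
    unfolding p_def using I_less[OF that] by (intro edgeI) auto
  have p_in_D: "Inr (p i) \<in> D" if "i \<in> ?I" for i
    using that by (simp add: D_def)
  have D_sub: "D \<subseteq> verts ?M"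
    using p_edge by (auto simp: D_def pverts_middle_graph)
  have "card D \<le> card ?I"
    unfolding D_def image_image by (intro card_image_le finite_path_cover_indices)
  then have card_D: "3 * card D \<le> 2 * n + 2"
    using card_path_cover_indices[of n] n by linarith

  have cover: "\<exists>j\<in>?I. v \<in> p j" if v: "v \<in> verts G" for v
  proof -
    obtain i where i: "i < n" "v = h i"
      using vertE[OF v] by blast
    obtain j where "j \<in> ?I" "i \<in> {j, j + 1}"
      using path_cover_indices_cover[of n i] i(1) n by auto
    then show ?thesis
      using i by (auto simp: p_def)
  qed

  have "\<exists>u\<in>D. x \<rightarrow>\<^bsub>?M\<^esub> u" if x: "x \<in> verts ?M" for x
  proof (cases x)
    case (Inl v)
    then have v: "v \<in> verts G"
      using x by (auto simp: pverts_middle_graph)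
    then obtain j where j: "j \<in> ?I" "v \<in> p j"
      using cover by blast
    then have "Inl v \<rightarrow>\<^bsub>?M\<^esub> Inr (p j)"
      using v p_edge by (simp add: parcs_middle_graph_iff)
    then show ?thesis
      using Inl j p_in_D by blast
  next
    case (Inr e)
    then have e: "e \<in> edge_set G"
      using x by (auto simp: pverts_middle_graph)
    then obtain u where u: "u \<in> e" "u \<in> verts G"
      by (auto elim: edge_setE)
    then obtain j where j: "j \<in> ?I" "u \<in> p j"
      using cover by blast
    \<comment> \<open>The chosen edge \<open>p j\<close> at an endpoint of \<open>e\<close>
      dominates \<open>e\<close> unless it is \<open>e\<close> itself; then a neighbouring chosen
      edge does.\<close>
    have "\<exists>k\<in>?I. e \<noteq> p k \<and> e \<inter> p k \<noteq> {}"
    proof (cases "e = p j")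
      case True
      obtain k where k: "k \<in> ?I" "k = j + 1 \<or> j = k + 1"
        using path_cover_indices_neighbour[of n j] j n by auto
      have "p j \<noteq> p k"
        using k I_less[OF j(1)] I_less[OF k(1)] by (auto simp: p_def doubleton_eq_iff h_eq)
      moreover have "p j \<inter> p k \<noteq> {}"
        using k(2) by (auto simp: p_def)
      ultimately show ?thesis
        using True k(1) by blast
    qed (use u j in blast)
    then obtain k where k: "k \<in> ?I" "e \<noteq> p k" "e \<inter> p k \<noteq> {}"
      by blast
    then have "Inr e \<rightarrow>\<^bsub>?M\<^esub> Inr (p k)"
      using e p_edge by (simp add: parcs_middle_graph_iff)
    then show ?thesis
      using Inr k(1) p_in_D by blast
  qed
  then have total: "total_dominating_set ?M D"
    using D_sub by (simp add: total_dominating_set_def)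

  let ?R = "?M \<restriction> (verts ?M - D)"
  interpret R: wf_digraph ?R
    by (rule M.wellformed_induce_subgraph)
  have R_adj: "x \<rightarrow>\<^bsub>?R\<^esub> y" if "x \<rightarrow>\<^bsub>?M\<^esub> y" "x \<notin> D" "y \<notin> D" for x y
    using that M.adj_in_verts[OF that(1)] by (auto simp: arcs_ends_conv)
  have Inl_notin: "Inl v \<notin> D" for v
    by (auto simp: D_def)
  \<comment> \<open>Positions at distance at least 2 are not consecutive on the path, so the edge
    joining them is outside \<open>D\<close> and serves as the midpoint of a two-step route.\<close>
  have chord: "Inl (h i) \<rightarrow>\<^sup>*\<^bsub>?R\<^esub> Inl (h j)" if ij: "i < n" "j < n" "j + 2 \<le> i \<or> i + 2 \<le> j" for i j
  proof -
    have e: "{h i, h j} \<in> edge_set G"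
      using ij by (intro edgeI) auto
    have "{h i, h j} \<noteq> p k" if "k \<in> ?I" for k
      using ij I_less[OF that] by (auto simp: p_def doubleton_eq_iff h_eq)
    then have notin: "Inr {h i, h j} \<notin> D"
      by (auto simp: D_def)
    have "Inl (h i) \<rightarrow>\<^bsub>?M\<^esub> Inr {h i, h j}" "Inr {h i, h j} \<rightarrow>\<^bsub>?M\<^esub> Inl (h j)"
      using e h_in ij by (simp_all add: parcs_middle_graph_iff)
    then have "Inl (h i) \<rightarrow>\<^bsub>?R\<^esub> Inr {h i, h j}" "Inr {h i, h j} \<rightarrow>\<^bsub>?R\<^esub> Inl (h j)"
      using R_adj notin Inl_notin by blast+
    then show ?thesis
      by (meson R.reachable_adjI R.reachable_trans)
  qed
  have Inl_reach: "Inl v \<rightarrow>\<^sup>*\<^bsub>?R\<^esub> Inl (h 0)" if v: "v \<in> verts G" for v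
  proof -
    obtain i where i: "i < n" "v = h i"
      using vertE[OF v] by blast
    consider "i = 0" | "i = 1" | "2 \<le> i"
      by linarith
    then show ?thesis
    proof cases
      case 1
      have "Inl v \<in> verts ?R"
        using v Inl_notin by (simp add: pverts_middle_graph)
      then have "Inl v \<rightarrow>\<^sup>*\<^bsub>?R\<^esub> Inl v"
        by (rule R.reachable_refl)
      then show ?thesis
        using 1 i by simp
    next
      case 2
      \<comment> \<open>Positions 0 and 1 are consecutive, so the route detours through position 3,
        which exists because \<open>4 \<le> n\<close>.\<close>
      have "Inl (h 1) \<rightarrow>\<^sup>*\<^bsub>?R\<^esub> Inl (h 3)" "Inl (h 3) \<rightarrow>\<^sup>*\<^bsub>?R\<^esub> Inl (h 0)"
        using chord[of 1 3] chord[of 3 0] n by simp_all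
      then show ?thesis
        using 2 i by (metis R.reachable_trans)
    next
      case 3
      then show ?thesis
        using chord[of i 0] i by simp
    qed
  qed
  have "Digraph_Component.connected ?R"
  proof (rule R.connected_if_all_reach)
    show "Inl (h 0) \<in> verts ?R"
      using h_in[of 0] n Inl_notin by (simp add: pverts_middle_graph)
    \<comment> \<open>A remaining edge is adjacent to its endpoints, which all remain.\<close>
    show "x \<rightarrow>\<^sup>*\<^bsub>?R\<^esub> Inl (h 0)" if x: "x \<in> verts ?R" for x
    proof (cases x)
      case (Inl v)
      then have "v \<in> verts G"
        using x by (auto simp: pverts_middle_graph)
      then show ?thesis
        using Inl Inl_reach by simp
    next
      case (Inr e)
      then have e: "e \<in> edge_set G" "Inr e \<notin> D"
        using x by (auto simp: pverts_middle_graph)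
      then obtain u where u: "u \<in> e" "u \<in> verts G"
        by (auto elim: edge_setE)
      then have "Inr e \<rightarrow>\<^bsub>?M\<^esub> Inl u"
        using e by (simp add: parcs_middle_graph_iff)
      then have "Inr e \<rightarrow>\<^bsub>?R\<^esub> Inl u"
        using R_adj e Inl_notin by blast
      then show ?thesis
        using Inr Inl_reach[OF u(2)] by (metis R.adj_reachable_trans)
    qed
  qed
  then show ?thesis
    using that total card_D by (simp add: total_outer_connected_dominating_set_def)
qed

theorem theorem2p4:
  fixes G :: "('a, 'b) pre_digraph" and n :: nat
  assumes "n \<ge> 4" and "complete_digraph n G"
  shows "int (\<gamma>\<^sub>t\<^sub>c (with_proj (middle_graph G))) = \<lceil>2 * real n / 3\<rceil>"
proof -
  let ?M = "with_proj (middle_graph G)"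
  let ?C = "card ` {D. total_outer_connected_dominating_set ?M D}"
  interpret graph G
    using assms(2) by (simp add: complete_digraph_def)
  interpret M: graph ?M
    by (rule graph_middle_graph) unfold_locales
  have "{D. total_outer_connected_dominating_set ?M D} \<subseteq> Pow (verts ?M)"
    by (auto simp: total_outer_connected_dominating_set_def total_dominating_set_def)
  \<comment> \<open>\<open>Min\<close> has its intended meaning only on a finite nonempty set; the
    witness \<open>D\<close> below supplies nonemptiness.\<close>
  then have fin: "finite ?C"
    using finite_subset M.finite_verts by blast
  obtain D where D: "total_outer_connected_dominating_set ?M D" "3 * card D \<le> 2 * n + 2"
    using complete_digraph_middle_graph_witness[OF assms] .
  have upper: "\<gamma>\<^sub>t\<^sub>c ?M \<le> card D"
    unfolding total_outer_connected_domination_number_def using D(1) fin by (intro Min_le) auto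
  have "\<gamma>\<^sub>t\<^sub>c ?M \<in> ?C"
    unfolding total_outer_connected_domination_number_def using D(1) fin by (intro Min_in) auto
  then have "2 * n \<le> 3 * \<gamma>\<^sub>t\<^sub>c ?M"
    using total_dominating_set_middle_graph_card assms(2)
    by (auto simp: total_outer_connected_dominating_set_def complete_digraph_def)
  \<comment> \<open>From \<open>2 * n \<le> 3 * g \<le> 2 * n + 2\<close> for the domination number
    \<open>g\<close> follows \<open>g - 1 < 2 * n / 3 \<le> g\<close>, which characterises the
    ceiling.\<close>
  then show ?thesis
    using upper D(2) by (intro ceiling_unique[symmetric]) linarith+
qed

end
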